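(* Let $\vartheta$ be a primitive random substitution. Then the RS-subshift $(X_\vartheta,S)$ is topologically transitive: for all non-empty open sets $U,V\subseteq X_\vartheta$ there exists a natural number $m\ge 0$ such that $S^m(U)\cap V\neq\emptyset$.
   Context: Let $\mathcal A=\{a_1,\dots,a_n\}$ be a finite alphabet, $\mathcal A^+$ the set of non-empty finite words over $\mathcal A$, and $\mathcal A^{\mathbb Z}$ the set of bi-infinite sequences with the product topology ($\mathcal A$ discrete). A random substitution (non-degenerate; the probabilities, all non-zero, play no role here and are suppressed) is a map $\vartheta$ assigning to each letter $a_i$ a non-empty finite set $\vartheta(a_i)\subset\mathcal A^+$ of realisations. A realisation of $\vartheta(u)$, for $u=u_1\cdots u_m\in\mathcal A^+$, is a word $x_1\cdots x_m$ with each $x_j\in\vartheta(u_j)$ chosen independently for each position. Realisations of $\vartheta^k(u)$ are defined inductively: $\vartheta^0$ is the identity, and the realisations of $\vartheta^{k+1}(u)$ are the realisations of $\vartheta(v)$ for $v$ a realisation of $\vartheta^k(u)$. $\vartheta$ is primitive if there is $k\in\mathbb N$ such that for all $1\le i,j\le n$ the letter $a_i$ is a subword of some realisation of $\vartheta^k(a_j)$. A word $u\in\mathcal A^+$ is $\vartheta$-legal if it is a subword of some realisation of $\vartheta^k(a_j)$ for some $k\in\mathbb N$ and some $j$. The RS-subshift is $X_\vartheta=\{w\in\mathcal A^{\mathbb Z}: \text{every finite non-empty subword of } w \text{ is } \vartheta\text{-legal}\}$, with the subspace topology and the shift $S(w)_i=w_{i+1}$. *)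

theory Defs
  imports "HOL-Analysis.Function_Topology" "HOL-Library.Sublist"
begin

text \<open>
  The alphabet is a (non-empty) type of class finite, words are lists, and ``subword'' means
  contiguous factor, i.e. \<^const>\<open>sublist\<close>. Only the sets of realisations are recorded; the
  (non-zero) probabilities attached to them are suppressed.
\<close>

definition random_substitution :: "('a::finite \<Rightarrow> 'a list set) \<Rightarrow> bool" where
  "random_substitution \<theta> \<longleftrightarrow> (\<forall>a. finite (\<theta> a) \<and> \<theta> a \<noteq> {} \<and> [] \<notin> \<theta> a)"

text \<open>Each occurrence of a letter is replaced independently, so equal letters of the word may
  receive different realisations.\<close>

definition realisations :: "('a \<Rightarrow> 'a list set) \<Rightarrow> 'a list \<Rightarrow> 'a list set" where
  "realisations \<theta> u = {concat xs | xs. list_all2 (\<lambda>x a. x \<in> \<theta> a) xs u}"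

primrec iter_realisations :: "('a \<Rightarrow> 'a list set) \<Rightarrow> nat \<Rightarrow> 'a list \<Rightarrow> 'a list set" where
  "iter_realisations \<theta> 0 u = {u}"
| "iter_realisations \<theta> (Suc k) u = (\<Union>v \<in> iter_realisations \<theta> k u. realisations \<theta> v)"

definition primitive :: "('a::finite \<Rightarrow> 'a list set) \<Rightarrow> bool" where
  "primitive \<theta> \<longleftrightarrow> (\<exists>k. \<forall>a b. \<exists>v \<in> iter_realisations \<theta> k [b]. sublist [a] v)"

definition legal :: "('a \<Rightarrow> 'a list set) \<Rightarrow> 'a list \<Rightarrow> bool" where
  "legal \<theta> u \<longleftrightarrow> u \<noteq> [] \<and> (\<exists>k a. \<exists>v \<in> iter_realisations \<theta> k [a]. sublist u v)"

definition rs_subshift :: "('a \<Rightarrow> 'a list set) \<Rightarrow> (int \<Rightarrow> 'a) set" where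
  "rs_subshift \<theta> = {w. \<forall>i j. i \<le> j \<longrightarrow> legal \<theta> (map w [i..j])}"

definition full_shift_topology :: "(int \<Rightarrow> 'a) topology" where
  "full_shift_topology = product_topology (\<lambda>_. discrete_topology UNIV) UNIV"

definition rs_topology :: "('a \<Rightarrow> 'a list set) \<Rightarrow> (int \<Rightarrow> 'a) topology" where
  "rs_topology \<theta> = subtopology full_shift_topology (rs_subshift \<theta>)"

definition shift :: "(int \<Rightarrow> 'a) \<Rightarrow> int \<Rightarrow> 'a" where
  "shift w = (\<lambda>i. w (i + 1))"

definition topologically_transitive :: "'x topology \<Rightarrow> ('x \<Rightarrow> 'x) \<Rightarrow> bool" where
  "topologically_transitive T f \<longleftrightarrow>
     (\<forall>U V. openin T U \<and> U \<noteq> {} \<and> openin T V \<and> V \<noteq> {} \<longrightarrow>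
        (\<exists>m::nat. (f ^^ m) ` U \<inter> V \<noteq> {}))"

end

theory Submission
  imports Defs
begin

text \<open>
  Given cylinders around \<open>x\<close> and \<open>y\<close> in the subshift, determined by words \<open>u\<close> and \<open>v\<close>, primitivity
  provides a power \<open>K\<close> such that both \<open>u\<close> and \<open>v\<close> occur in realisations of \<open>\<theta>\<^sup>K(c)\<close> for every letter
  \<open>c\<close>. Applying \<open>\<theta>\<^sup>K\<close> to the bi-infinite sequence \<open>x\<close>, with the realisation at position 0 chosen to
  contain \<open>u\<close> and the one at position 1 chosen to contain \<open>v\<close>, yields a point of the subshift in
  which \<open>u\<close> is followed by \<open>v\<close>.
\<close>

subsection \<open>Realisations of powers\<close>

lemma realisations_append:
  assumes "x \<in> realisations \<theta> u" "y \<in> realisations \<theta> v"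
  shows "x @ y \<in> realisations \<theta> (u @ v)"
proof -
  obtain xs ys where "x = concat xs" "list_all2 (\<lambda>x a. x \<in> \<theta> a) xs u"
    and "y = concat ys" "list_all2 (\<lambda>x a. x \<in> \<theta> a) ys v"
    using assms by (auto simp: realisations_def)
  then have "x @ y = concat (xs @ ys)" "list_all2 (\<lambda>x a. x \<in> \<theta> a) (xs @ ys) (u @ v)"
    by (auto intro: list_all2_appendI)
  then show ?thesis unfolding realisations_def by blast
qed

lemma iter_realisations_append:
  assumes "x \<in> iter_realisations \<theta> k u" "y \<in> iter_realisations \<theta> k v"
  shows "x @ y \<in> iter_realisations \<theta> k (u @ v)"
  using assms by (induction k arbitrary: x y) (auto intro: realisations_append)

lemma iter_realisations_Nil: "[] \<in> iter_realisations \<theta> k []"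
proof (induction k)
  case (Suc k)
  have "[] \<in> realisations \<theta> []" by (auto simp: realisations_def)
  with Suc show ?case by auto
qed simp

text \<open>Indexing by a list of positions lets \<open>f\<close> choose different realisations for
  equal letters and makes the result applicable to windows of a bi-infinite sequence.\<close>

lemma iter_realisations_concat:
  assumes "\<And>i. i \<in> set is \<Longrightarrow> f i \<in> iter_realisations \<theta> k [x i]"
  shows "concat (map f is) \<in> iter_realisations \<theta> k (map x is)"
  using assms
proof (induction "is")
  case (Cons i "is")
  then have "f i @ concat (map f is) \<in> iter_realisations \<theta> k ([x i] @ map x is)"
    by (intro iter_realisations_append) auto
  then show ?case by simp
qed (simp add: iter_realisations_Nil)

lemma iter_realisations_add:
  assumes "v \<in> iter_realisations \<theta> k u" "w \<in> iter_realisations \<theta> l v"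
  shows "w \<in> iter_realisations \<theta> (k + l) u"
  using assms by (induction l arbitrary: w) auto

lemma realisations_not_Nil:
  assumes "random_substitution \<theta>" "u \<noteq> []" "v \<in> realisations \<theta> u"
  shows "v \<noteq> []"
proof -
  obtain xs where xs: "v = concat xs" "list_all2 (\<lambda>x a. x \<in> \<theta> a) xs u"
    using assms(3) by (auto simp: realisations_def)
  show ?thesis
  proof (cases u)
    case (Cons a u')
    then obtain y ys where "xs = y # ys" "y \<in> \<theta> a"
      using xs(2) by (auto simp: list_all2_Cons2)
    moreover have "[] \<notin> \<theta> a"
      using assms(1) by (simp add: random_substitution_def)
    ultimately show ?thesis using xs(1) by auto
  qed (use assms in simp)
qed

lemma realisations_nonempty:
  assumes "random_substitution \<theta>"
  shows "realisations \<theta> u \<noteq> {}"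
proof -
  define g where "g a = (SOME x. x \<in> \<theta> a)" for a
  have "g a \<in> \<theta> a" for a
    using assms unfolding g_def random_substitution_def by (simp add: some_in_eq)
  then have "list_all2 (\<lambda>x a. x \<in> \<theta> a) (map g u) u"
    by (simp add: list_all2_conv_all_nth)
  then show ?thesis unfolding realisations_def by blast
qed

lemma iter_realisations_not_Nil:
  assumes "random_substitution \<theta>" "u \<noteq> []" "v \<in> iter_realisations \<theta> k u"
  shows "v \<noteq> []"
  using assms(3)
proof (induction k arbitrary: v)
  case (Suc k)
  then obtain w where "w \<in> iter_realisations \<theta> k u" "v \<in> realisations \<theta> w" by auto
  with Suc.IH realisations_not_Nil[OF assms(1)] show ?case by blast
qed (use assms in simp)

lemma iter_realisations_nonempty:
  assumes "random_substitution \<theta>"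
  shows "iter_realisations \<theta> k u \<noteq> {}"
  by (induction k) (use realisations_nonempty[OF assms] in auto)

text \<open>The letters of \<open>v\<close> outside the chosen occurrence of \<open>u\<close>
  receive arbitrary realisations, which exist because every \<open>\<theta> a\<close> is
  non-empty.\<close>

lemma iter_realisations_sublist:
  assumes "random_substitution \<theta>" "sublist u v" "w \<in> iter_realisations \<theta> k u"
  obtains w' where "w' \<in> iter_realisations \<theta> k v" "sublist w w'"
proof -
  obtain p s where v: "v = p @ u @ s" using assms(2) by (auto simp: sublist_def)
  obtain p' s' where "p' \<in> iter_realisations \<theta> k p" "s' \<in> iter_realisations \<theta> k s"
    using iter_realisations_nonempty[OF assms(1)] by blast
  then have "p' @ w @ s' \<in> iter_realisations \<theta> k v"
    unfolding v using assms(3) by (intro iter_realisations_append)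
  then show ?thesis using that by blast
qed

text \<open>If \<open>u\<close> lies in a level \<open>l\<close> realisation \<open>w\<close> of a
  letter, then \<open>v\<close> lies in a realisation of \<open>w\<close> under \<open>k\<close>
  further steps, hence in a level \<open>l + k\<close> realisation of the same letter.\<close>

lemma legal_iter_realisations:
  assumes "random_substitution \<theta>" "legal \<theta> u" "v \<in> iter_realisations \<theta> k u"
  shows "legal \<theta> v"
proof -
  obtain l a w where "u \<noteq> []" "w \<in> iter_realisations \<theta> l [a]" "sublist u w"
    using assms(2) by (auto simp: legal_def)
  moreover obtain w' where "w' \<in> iter_realisations \<theta> k w" "sublist v w'"
    using iter_realisations_sublist assms(1,3) calculation(3) by blast
  ultimately show ?thesis
    unfolding legal_def
    using iter_realisations_add iter_realisations_not_Nil[OF assms(1) _ assms(3)] by blast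
qed

lemma legal_sublist: "legal \<theta> v \<Longrightarrow> sublist u v \<Longrightarrow> u \<noteq> [] \<Longrightarrow> legal \<theta> u"
  unfolding legal_def using sublist_order.order.trans by blast

text \<open>Primitivity leads from any letter to the letter \<open>a\<close> whose realisation
  contains \<open>u\<close>. A threshold, rather than a single power, allows two legal words to be
  served by one common power.\<close>

lemma legal_eventually_in_all_letters:
  assumes "random_substitution \<theta>" "primitive \<theta>" "legal \<theta> u"
  obtains K0 where "\<And>K c. K \<ge> K0 \<Longrightarrow> \<exists>v \<in> iter_realisations \<theta> K [c]. sublist u v"
proof -
  obtain k0 where k0: "\<And>a b. \<exists>v \<in> iter_realisations \<theta> k0 [b]. sublist [a] v"
    using assms(2) unfolding primitive_def by blast
  obtain k a v where v: "v \<in> iter_realisations \<theta> k [a]" "sublist u v"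
    using assms(3) by (auto simp: legal_def)
  have "\<exists>v \<in> iter_realisations \<theta> K [c]. sublist u v" if "K \<ge> k0 + k" for K c
  proof -
    \<comment> \<open>The surplus steps are spent first: they turn \<open>c\<close> into some
      non-empty word, and any letter \<open>b\<close> of it serves as the start for the
      \<open>k0\<close> steps of primitivity.\<close>
    define d where "d = K - (k0 + k)"
    have K: "K = d + (k0 + k)" using that by (simp add: d_def)
    obtain x where x: "x \<in> iter_realisations \<theta> d [c]"
      using iter_realisations_nonempty[OF assms(1)] by blast
    then obtain b x' where "x = b # x'"
      using iter_realisations_not_Nil[OF assms(1)] by (metis list.distinct(1) list.exhaust)
    then have "sublist [b] x" by (simp add: sublist_Cons_right)
    obtain y where y: "y \<in> iter_realisations \<theta> k0 [b]" "sublist [a] y"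
      using k0 by blast
    obtain y' where y': "y' \<in> iter_realisations \<theta> k0 x" "sublist y y'"
      using iter_realisations_sublist[OF assms(1) \<open>sublist [b] x\<close> y(1)] .
    then have "sublist [a] y'" using y(2) sublist_order.order.trans by blast
    then obtain z where z: "z \<in> iter_realisations \<theta> k y'" "sublist v z"
      using iter_realisations_sublist assms(1) v(1) by blast
    have "z \<in> iter_realisations \<theta> K [c]"
      unfolding K using iter_realisations_add[OF x iter_realisations_add[OF y'(1) z(1)]] .
    moreover have "sublist u z" using v(2) z(2) sublist_order.order.trans by blast
    ultimately show ?thesis by blast
  qed
  then show ?thesis using that by blast
qed

subsection \<open>Bi-infinite concatenation\<close>

lemma length_concat_map_ge:
  assumes "\<And>i. g i \<noteq> []"
  shows "length is \<le> length (concat (map g is))"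
proof (induction "is")
  case (Cons i "is")
  moreover have "Suc 0 \<le> length (g i)" using assms by (simp add: Suc_le_eq)
  ultimately show ?case by simp
qed simp

text \<open>The finite concatenations are prefixes of one another, so they define a common limit
  sequence \<open>h\<close>.\<close>

lemma one_sided_concat:
  fixes g :: "nat \<Rightarrow> 'a list"
  assumes "\<And>i. g i \<noteq> []"
  obtains h where "\<And>n i. i < length (concat (map g [0..<n])) \<Longrightarrow> concat (map g [0..<n]) ! i = h i"
proof
  fix n i
  let ?c = "\<lambda>n. concat (map g [0..<n])"
  assume i: "i < length (?c n)"
  have pre: "?c b ! i = ?c a ! i" if "a \<le> b" "i < length (?c a)" for a b
  proof -
    have "[0..<b] = [0..<a] @ [a..<b]" using that(1) upt_add_eq_append[of 0 a "b - a"] by simp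
    then show ?thesis using that(2) by (simp add: nth_append)
  qed
  \<comment> \<open>Every block has at least one letter, so the first \<open>Suc i\<close> blocks
    already reach position \<open>i\<close>; \<open>h i\<close> is read off there.\<close>
  have "i < length (?c (Suc i))" using length_concat_map_ge[of g "[0..<Suc i]", OF assms] by simp
  then show "?c n ! i = ?c (Suc i) ! i"
    using pre[of n "Suc i"] pre[of "Suc i" n] i by (cases "n \<le> Suc i") auto
qed

lemma map_of_nat_upt: "map int [0..<n] = [0..int n - 1]"
proof (induction n)
  case (Suc n)
  have "[0..int n] = [0..int n - 1] @ [int n]" by (rule upto_rec2) simp
  with Suc show ?case by simp
qed simp

lemma rev_map_neg_upt: "rev (map (\<lambda>i. - 1 - int i) [0..<n]) = [- int n..-1]"
proof (induction n)
  case (Suc n)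
  have "[- 1 - int n..-1] = (- 1 - int n) # [- 1 - int n + 1..-1]" by (rule upto_rec1) simp
  with Suc show ?case by simp
qed simp

lemma upto_append: "i \<le> j \<Longrightarrow> j \<le> k + 1 \<Longrightarrow> [i..k] = [i..j - 1] @ [j..k]"
  using upto_split1[of i j k] by (cases "j = k + 1") auto

lemma sublist_upto: "a \<le> i \<Longrightarrow> i \<le> j + 1 \<Longrightarrow> j \<le> b \<Longrightarrow> sublist [i..j] [a..b]"
  using upto_append[of a i b] upto_append[of i "j + 1" b]
  by (auto simp: sublist_def)

lemma rev_concat_map: "rev (concat (map f is)) = concat (map (rev \<circ> f) (rev is))"
  by (simp add: rev_concat rev_map)

text \<open>The concatenation is placed such that \<open>f 0\<close> starts at position 0.\<close>

lemma two_sided_concat: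
  fixes f :: "int \<Rightarrow> 'a list"
  assumes "\<And>i. f i \<noteq> []"
  obtains y where "\<And>m n. map y [- int (length (concat (map f [- int m..-1])))..
      int (length (concat (map f [0..int n - 1]))) - 1] =
      concat (map f [- int m..-1]) @ concat (map f [0..int n - 1])"
proof -
  define r where "r = (\<lambda>i. f (int i))"
  \<comment> \<open>The left half is read outwards from position -1: the blocks come in descending
    order and each is reversed, so that it is again a one-sided concatenation.\<close>
  define l where "l = (\<lambda>i. rev (f (- 1 - int i)))"
  obtain hr where hr: "\<And>n i. i < length (concat (map r [0..<n])) \<Longrightarrow> concat (map r [0..<n]) ! i = hr i"
    using one_sided_concat[of r] assms by (auto simp: r_def)
  obtain hl where hl: "\<And>n i. i < length (concat (map l [0..<n])) \<Longrightarrow> concat (map l [0..<n]) ! i = hl i"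
    using one_sided_concat[of l] assms by (auto simp: l_def)
  define y where "y i = (if i \<ge> 0 then hr (nat i) else hl (nat (- 1 - i)))" for i
  have "map y [- int (length (concat (map f [- int m..-1])))..
      int (length (concat (map f [0..int n - 1]))) - 1] =
      concat (map f [- int m..-1]) @ concat (map f [0..int n - 1])" (is "map y [- int ?a..int ?b - 1] = ?L @ ?R")
    for m n
  proof -
    have R: "?R = concat (map r [0..<n])"
      by (simp add: map_of_nat_upt[symmetric] r_def o_def)
    have L: "?L = rev (concat (map l [0..<m]))"
      by (simp add: rev_map_neg_upt[symmetric] rev_concat_map l_def o_def rev_map)
    have "map y [0..int ?b - 1] = ?R"
      unfolding map_of_nat_upt[symmetric]
      by (rule nth_equalityI) (auto simp: y_def R hr map_of_nat_upt)
    moreover have "map y [- int ?a..-1] = ?L"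
    proof -
      have "map hl [0..<?a] = concat (map l [0..<m])"
        unfolding L by (rule nth_equalityI) (simp_all add: hl)
      then have "rev (map hl [0..<?a]) = ?L" unfolding L by simp
      moreover have "map y [- int ?a..-1] = rev (map hl [0..<?a])"
        unfolding rev_map_neg_upt[symmetric] by (simp add: rev_map y_def)
      ultimately show ?thesis by simp
    qed
    moreover have "[- int ?a..int ?b - 1] = [- int ?a..-1] @ [0..int ?b - 1]"
      using upto_append[of "- int ?a" 0 "int ?b - 1"] by simp
    ultimately show ?thesis by simp
  qed
  then show ?thesis using that by blast
qed

subsection \<open>The subshift\<close>

text \<open>Every window of \<open>y\<close> lies in the image of a central window of
  \<open>x\<close>; that window is legal, and realisations preserve legality.\<close>

lemma two_sided_realisation_in_subshift:
  assumes rs: "random_substitution \<theta>" and x: "x \<in> rs_subshift \<theta>"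
    and f: "\<And>i. f i \<in> iter_realisations \<theta> k [x i]"
    and y: "\<And>m n. map y [- int (length (concat (map f [- int m..-1])))..
      int (length (concat (map f [0..int n - 1]))) - 1] =
      concat (map f [- int m..-1]) @ concat (map f [0..int n - 1])"
  shows "y \<in> rs_subshift \<theta>"
  unfolding rs_subshift_def
proof (intro CollectI allI impI)
  fix i j :: int assume "i \<le> j"
  \<comment> \<open>Since blocks are non-empty, \<open>m\<close> blocks on each side cover at least
    \<open>m\<close> positions there, enough for \<open>[i..j]\<close>. The summand 1 gives
    \<open>j \<le> int m - 1\<close> and keeps the window of \<open>x\<close> non-empty.\<close>
  define m where "m = nat (\<bar>i\<bar> + \<bar>j\<bar> + 1)"
  let ?L = "concat (map f [- int m..-1])" and ?R = "concat (map f [0..int m - 1])"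
  have f0: "f l \<noteq> []" for l using iter_realisations_not_Nil[OF rs _ f] by blast
  have "m \<le> length ?L" "m \<le> length ?R"
    using length_concat_map_ge[of f "[- int m..-1]", OF f0]
      length_concat_map_ge[of f "[0..int m - 1]", OF f0] by simp_all
  moreover have m: "- int m \<le> i" "j \<le> int m - 1" by (simp_all add: m_def)
  ultimately have "sublist [i..j] [- int (length ?L)..int (length ?R) - 1]"
    using \<open>i \<le> j\<close> m by (intro sublist_upto) linarith+
  then have "sublist (map y [i..j]) (?L @ ?R)"
    unfolding y[symmetric] by (rule map_mono_sublist)
  moreover have "?L @ ?R = concat (map f [- int m..int m - 1])"
    using upto_append[of "- int m" 0 "int m - 1"] by simp
  moreover have "legal \<theta> (map x [- int m..int m - 1])"
    using x by (simp add: rs_subshift_def m_def)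
  then have "legal \<theta> (concat (map f [- int m..int m - 1]))"
    by (rule legal_iter_realisations[OF rs]) (rule iter_realisations_concat[OF f])
  ultimately show "legal \<theta> (map y [i..j])"
    using \<open>i \<le> j\<close> legal_sublist[of \<theta> "?L @ ?R" "map y [i..j]"] by simp
qed

lemma translate_in_rs_subshift:
  assumes "y \<in> rs_subshift \<theta>"
  shows "(\<lambda>i. y (i + c)) \<in> rs_subshift \<theta>"
proof -
  have "map (\<lambda>i. y (i + c)) [i..j] = map y [i + c..j + c]" for i j
    by (rule nth_equalityI) (auto simp: algebra_simps)
  then show ?thesis using assms by (simp add: rs_subshift_def)
qed

lemma shift_funpow: "(shift ^^ m) w = (\<lambda>i. w (i + int m))"
  by (induction m) (auto simp: shift_def algebra_simps)

text \<open>The point \<open>x\<close> only supplies letters to be substituted; \<open>u\<close> and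
  \<open>v\<close> need not occur in it. The order \<open>a \<le> b\<close> is what later makes the
  shift exponent a natural number.\<close>

lemma rs_subshift_two_words:
  assumes rs: "random_substitution \<theta>" and "primitive \<theta>"
    and x: "x \<in> rs_subshift \<theta>" and u: "legal \<theta> u" and v: "legal \<theta> v"
  obtains y a b where "y \<in> rs_subshift \<theta>" "a \<le> b"
    "\<And>t. t < length u \<Longrightarrow> y (int (a + t)) = u ! t"
    "\<And>t. t < length v \<Longrightarrow> y (int (b + t)) = v ! t"
proof -
  obtain Ku where Ku: "\<And>K c. K \<ge> Ku \<Longrightarrow> \<exists>w \<in> iter_realisations \<theta> K [c]. sublist u w"
    using legal_eventually_in_all_letters[OF assms(1,2) u] by blast
  obtain Kv where Kv: "\<And>K c. K \<ge> Kv \<Longrightarrow> \<exists>w \<in> iter_realisations \<theta> K [c]. sublist v w"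
    using legal_eventually_in_all_letters[OF assms(1,2) v] by blast
  define K where "K = max Ku Kv"
  obtain p s where u': "p @ u @ s \<in> iter_realisations \<theta> K [x 0]"
    using Ku[of K "x 0"] by (auto simp: K_def sublist_def)
  obtain p' s' where v': "p' @ v @ s' \<in> iter_realisations \<theta> K [x 1]"
    using Kv[of K "x 1"] by (auto simp: K_def sublist_def)
  define f where "f i = (if i = 0 then p @ u @ s else if i = 1 then p' @ v @ s'
    else SOME w. w \<in> iter_realisations \<theta> K [x i])" for i
  have f: "f i \<in> iter_realisations \<theta> K [x i]" for i
    using u' v' iter_realisations_nonempty[OF rs] by (auto simp: f_def some_in_eq)
  have "f i \<noteq> []" for i using iter_realisations_not_Nil[OF rs _ f] by blast
  then obtain y where y: "\<And>m n. map y [- int (length (concat (map f [- int m..-1])))..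
      int (length (concat (map f [0..int n - 1]))) - 1] =
      concat (map f [- int m..-1]) @ concat (map f [0..int n - 1])"
    using two_sided_concat[of f] by blast
  have "[0..1::int] = [0, 1]" by (simp add: upto_rec1)
  \<comment> \<open>With \<open>m = 0\<close> the left half is empty, so only the blocks of
    positions 0 and 1 remain.\<close>
  with y[of 0 2] have y01: "map y [0..int (length (f 0 @ f 1)) - 1] = f 0 @ f 1" by simp
  have y_nth: "y (int q) = (f 0 @ f 1) ! q" if "q < length (f 0 @ f 1)" for q
    using that arg_cong[OF y01, of "\<lambda>l. l ! q"] by simp
  show ?thesis
  proof (rule that)
    show "y \<in> rs_subshift \<theta>" by (rule two_sided_realisation_in_subshift[OF rs x f y])
    \<comment> \<open>The offsets \<open>a\<close> and \<open>b\<close> are the lengths of what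
      precedes \<open>u\<close> and \<open>v\<close> in \<open>f 0 @ f 1\<close>.\<close>
    show "length p \<le> length (p @ u @ s @ p')" by simp
    show "y (int (length p + t)) = u ! t" if "t < length u" for t
      using that by (subst y_nth) (auto simp: f_def nth_append)
    show "y (int (length (p @ u @ s @ p') + t)) = v ! t" if "t < length v" for t
      using that by (subst y_nth) (auto simp: f_def nth_append)
  qed
qed

text \<open>A basic open set of the product topology constrains only finitely many coordinates, and
  \<open>N\<close> bounds their absolute values.\<close>

lemma rs_topology_cylinder:
  assumes "openin (rs_topology \<theta>) U" "x \<in> U"
  obtains N :: nat where
    "\<And>w. w \<in> rs_subshift \<theta> \<Longrightarrow> (\<And>i. \<bar>i\<bar> \<le> int N \<Longrightarrow> w i = x i) \<Longrightarrow> w \<in> U"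
proof -
  obtain T where T: "openin full_shift_topology T" "U = T \<inter> rs_subshift \<theta>"
    using assms(1) by (auto simp: rs_topology_def openin_subtopology)
  then obtain B where fin: "finite {i. B i \<noteq> UNIV}"
    and xB: "x \<in> Pi\<^sub>E UNIV B" and BT: "Pi\<^sub>E UNIV B \<subseteq> T"
    using assms(2) unfolding full_shift_topology_def openin_product_topology_alt by auto
  \<comment> \<open>The inserted 0 keeps the maximum defined when no coordinate is
    constrained.\<close>
  define N where "N = nat (Max (insert 0 (abs ` {i. B i \<noteq> UNIV})))"
  have N: "\<bar>i\<bar> \<le> int N" if "B i \<noteq> UNIV" for i
  proof -
    have "\<bar>i\<bar> \<le> Max (insert 0 (abs ` {i. B i \<noteq> UNIV}))"
      using that fin by (intro Max_ge) auto
    also have "\<dots> = int N"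
      using fin by (simp add: N_def)
    finally show ?thesis .
  qed
  have "w \<in> U" if "w \<in> rs_subshift \<theta>" "\<And>i. \<bar>i\<bar> \<le> int N \<Longrightarrow> w i = x i" for w
  proof -
    have "w i \<in> B i" for i
      using N[of i] that(2)[of i] xB by (cases "B i = UNIV") (auto simp: PiE_def Pi_def)
    then show ?thesis using BT T(2) that(1) by (auto simp: PiE_def Pi_def)
  qed
  then show ?thesis using that by blast
qed

theorem corollary18:
  fixes \<theta> :: "'a::finite \<Rightarrow> 'a list set"
  assumes "random_substitution \<theta>"
    and "primitive \<theta>"
  shows "topologically_transitive (rs_topology \<theta>) shift"
  unfolding topologically_transitive_def
proof (intro allI impI, elim conjE)
  fix U V :: "(int \<Rightarrow> 'a) set"
  assume U: "openin (rs_topology \<theta>) U" "U \<noteq> {}" and V: "openin (rs_topology \<theta>) V" "V \<noteq> {}"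
  obtain x x' where "x \<in> U" "x' \<in> V" using U V by blast
  then have x: "x \<in> rs_subshift \<theta>" and x': "x' \<in> rs_subshift \<theta>"
    using U(1) V(1) by (auto simp: rs_topology_def openin_subtopology)
  obtain M where M: "\<And>w. w \<in> rs_subshift \<theta> \<Longrightarrow> (\<And>i. \<bar>i\<bar> \<le> int M \<Longrightarrow> w i = x i) \<Longrightarrow> w \<in> U"
    using rs_topology_cylinder[OF U(1) \<open>x \<in> U\<close>] by blast
  obtain N where N: "\<And>w. w \<in> rs_subshift \<theta> \<Longrightarrow> (\<And>i. \<bar>i\<bar> \<le> int N \<Longrightarrow> w i = x' i) \<Longrightarrow> w \<in> V"
    using rs_topology_cylinder[OF V(1) \<open>x' \<in> V\<close>] by blast
  define R where "R = int (max M N)"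
  have legal: "legal \<theta> (map x [- R..R])" "legal \<theta> (map x' [- R..R])"
    using x x' by (auto simp: rs_subshift_def R_def)
  obtain y a b where y: "y \<in> rs_subshift \<theta>" and "a \<le> b"
    and ya: "\<And>t. t < length (map x [- R..R]) \<Longrightarrow> y (int (a + t)) = map x [- R..R] ! t"
    and yb: "\<And>t. t < length (map x' [- R..R]) \<Longrightarrow> y (int (b + t)) = map x' [- R..R] ! t"
    using rs_subshift_two_words[OF assms x legal] by blast
  \<comment> \<open>Position \<open>i\<close> of the window \<open>[- R..R]\<close> is entry
    \<open>i + R\<close> of the corresponding list.\<close>
  have window: "\<exists>t. i = int t - R \<and> t < nat (2 * R + 1)" if "\<bar>i\<bar> \<le> int M \<or> \<bar>i\<bar> \<le> int N" for i
    using that by (intro exI[of _ "nat (i + R)"]) (auto simp: R_def)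
  \<comment> \<open>The centre of the first copied word, at \<open>a + R\<close> in
    \<open>y\<close>, is moved to the origin.\<close>
  define z where "z i = y (i + (int a + R))" for i
  have z: "z \<in> rs_subshift \<theta>"
    unfolding z_def by (rule translate_in_rs_subshift[OF y])
  have "z \<in> U"
  proof (rule M[OF z])
    fix i assume "\<bar>i\<bar> \<le> int M"
    then obtain t where t: "i = int t - R" "t < nat (2 * R + 1)"
      using window by blast
    then show "z i = x i"
      using ya[of t] by (simp add: z_def add.commute)
  qed
  \<comment> \<open>The total translation is now \<open>b + R\<close>, which centres the second
    copied word.\<close>
  moreover have "(shift ^^ (b - a)) z \<in> V"
  proof (rule N)
    show "(shift ^^ (b - a)) z \<in> rs_subshift \<theta>"
      unfolding shift_funpow by (rule translate_in_rs_subshift[OF z])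
    fix i assume "\<bar>i\<bar> \<le> int N"
    then obtain t where t: "i = int t - R" "t < nat (2 * R + 1)"
      using window by blast
    then show "(shift ^^ (b - a)) z i = x' i"
      using yb[of t] \<open>a \<le> b\<close> by (simp add: shift_funpow of_nat_diff z_def add.commute)
  qed
  ultimately show "\<exists>m. (shift ^^ m) ` U \<inter> V \<noteq> {}" by blast
qed

end
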